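(* Let $\alpha\in\ell^2$ and $1<q<\infty$. The Rhaly operator $R_\alpha$ belongs to the Schatten class $\mathcal{S}^q(\ell^2)$ if and only if the sequence $(\sigma_k)_k$ belongs to $\ell^q$.
   Context: $\mathbb{N}=\{0,1,2,\dots\}$; $(R_\alpha f)(k)=\alpha_k\sum_{j=0}^kf(j)$ on $\ell^2$ (square-summable functions $\mathbb{N}\to\mathbb{C}$). $\sigma_k=(\sum_{j=2^k}^{2^{k+1}-1}(j+1)|\alpha_j|^2)^{1/2}$ for $k\in\mathbb{N}$ (and $\sigma_{-1}=|\alpha_0|$). $T\in\mathcal{S}^q(\ell^2)$ means $(a_n(T))_{n\ge1}\in\ell^q$, where $a_{n+1}(T)=\inf\{\|T-P\|:\operatorname{rank}P\le n\}$. *)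

theory Defs
  imports "HOL-Analysis.Analysis"
begin

definition l2 :: "(nat \<Rightarrow> complex) set" where
  "l2 = {f. summable (\<lambda>n. (cmod (f n))^2)}"

definition l2nrm :: "(nat \<Rightarrow> complex) \<Rightarrow> ennreal" where
  "l2nrm f = (if summable (\<lambda>n. (cmod (f n))^2)
              then ennreal (sqrt (\<Sum>n. (cmod (f n))^2)) else \<infinity>)"

definition opnorm :: "((nat \<Rightarrow> complex) \<Rightarrow> (nat \<Rightarrow> complex)) \<Rightarrow> ennreal" where
  "opnorm T = (SUP f \<in> {f. f \<in> l2 \<and> l2nrm f \<le> 1}. l2nrm (T f))"

definition finite_rank_le ::
  "nat \<Rightarrow> ((nat \<Rightarrow> complex) \<Rightarrow> (nat \<Rightarrow> complex)) \<Rightarrow> bool" where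
  "finite_rank_le n P \<longleftrightarrow>
     (\<forall>f\<in>l2. P f \<in> l2) \<and>
     (\<forall>f\<in>l2. \<forall>g\<in>l2. P (\<lambda>k. f k + g k) = (\<lambda>k. P f k + P g k)) \<and>
     (\<forall>f\<in>l2. \<forall>c. P (\<lambda>k. c * f k) = (\<lambda>k. c * P f k)) \<and>
     (\<exists>C::real. \<forall>f\<in>l2. l2nrm (P f) \<le> ennreal C * l2nrm f) \<and>
     (\<exists>v :: nat \<Rightarrow> nat \<Rightarrow> complex. \<forall>f\<in>l2. \<exists>c :: nat \<Rightarrow> complex.
        P f = (\<lambda>k. \<Sum>i<n. c i * v i k))"

text \<open>Approximation numbers: approx_num T n = a_(n+1)(T)
  = inf { ||T - P|| : rank P <= n }.\<close>
definition approx_num ::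
  "((nat \<Rightarrow> complex) \<Rightarrow> (nat \<Rightarrow> complex)) \<Rightarrow> nat \<Rightarrow> ennreal" where
  "approx_num T n = (INF P \<in> {P. finite_rank_le n P}. opnorm (\<lambda>f k. T f k - P f k))"

definition schatten :: "real \<Rightarrow> ((nat \<Rightarrow> complex) \<Rightarrow> (nat \<Rightarrow> complex)) \<Rightarrow> bool" where
  "schatten q T \<longleftrightarrow> (\<forall>n. approx_num T n < \<infinity>) \<and>
     summable (\<lambda>n. (enn2real (approx_num T n)) powr q)"

definition rhaly :: "(nat \<Rightarrow> complex) \<Rightarrow> (nat \<Rightarrow> complex) \<Rightarrow> (nat \<Rightarrow> complex)" where
  "rhaly \<alpha> f = (\<lambda>k. \<alpha> k * (\<Sum>j\<le>k. f j))"

definition rsigma :: "(nat \<Rightarrow> complex) \<Rightarrow> nat \<Rightarrow> real" where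
  "rsigma \<alpha> k = sqrt (\<Sum>j\<in>{2^k..<2^(k+1)}. real (j+1) * (cmod (\<alpha> j))^2)"

text \<open>The full sequence (sigma_k)_(k>=-1), shifted by one: index 0 is sigma_(-1) = |alpha_0|.\<close>
definition rsigma_seq :: "(nat \<Rightarrow> complex) \<Rightarrow> nat \<Rightarrow> real" where
  "rsigma_seq \<alpha> k = (if k = 0 then cmod (\<alpha> 0) else rsigma \<alpha> (k - 1))"

end

theory Submission
  imports Defs
begin

text \<open>
  Sufficiency: fix \<open>t > 0\<close>. On the dyadic blocks with \<open>\<sigma>\<^sub>k < t\<close> the operator has norm \<open>O(t)\<close> by a
  dyadic Hardy inequality. A block with \<open>\<sigma>\<^sub>k \<ge> t\<close> is cut into at most \<open>3 \<sigma>\<^sub>k / t\<close> intervals such that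
  replacing the partial sum up to \<open>i\<close> by the partial sum up to the left end of the interval containing \<open>i\<close>
  costs at most \<open>t\<close> in norm and leaves one dimension per interval. So the approximation numbers
  are dominated, up to a constant, by the decreasing rearrangement of the array \<open>3 \<sigma>\<^sub>k / m\<close> with
  \<open>m \<ge> 1\<close>, which is \<open>q\<close>-summable because \<open>q > 1\<close>.

  Necessity: on the span of suitable test functions attached to \<open>N\<close> blocks, at mutual distance at
  least 3 and with \<open>\<sigma>\<^sub>k \<ge> s\<close>, the operator is bounded below by \<open>s / 3\<close>. An operator of rank less than
  \<open>N\<close> has a kernel there, so the first \<open>N\<close> approximation numbers are at least \<open>s / 3\<close>.
\<close>

section \<open>Norms and operators of finite rank\<close>

lemma l2nrm_le:
  assumes "0 \<le> c" and "\<And>M. (\<Sum>i<M. (cmod (g i))\<^sup>2) \<le> c\<^sup>2"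
  shows "l2nrm g \<le> ennreal c"
proof -
  have sm: "summable (\<lambda>i. (cmod (g i))\<^sup>2)"
    by (rule bounded_imp_summable[where B = "c\<^sup>2"]) (use assms(2)[of "Suc _"] in \<open>auto simp: lessThan_Suc_atMost\<close>)
  have "(\<Sum>i. (cmod (g i))\<^sup>2) \<le> c\<^sup>2"
    by (rule suminf_le_const[OF sm]) (use assms in auto)
  then have "sqrt (\<Sum>i. (cmod (g i))\<^sup>2) \<le> c"
    using assms(1) real_le_lsqrt real_sqrt_le_iff real_sqrt_unique by metis
  with sm show ?thesis
    by (simp add: l2nrm_def ennreal_leI)
qed

lemma l2nrm_ge:
  assumes "finite I"
  shows "ennreal (sqrt (\<Sum>i\<in>I. (cmod (g i))\<^sup>2)) \<le> l2nrm g"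
proof (cases "summable (\<lambda>i. (cmod (g i))\<^sup>2)")
  case True
  then have "(\<Sum>i\<in>I. (cmod (g i))\<^sup>2) \<le> (\<Sum>i. (cmod (g i))\<^sup>2)"
    by (intro sum_le_suminf assms) auto
  then show ?thesis
    using True by (simp add: l2nrm_def ennreal_leI)
qed (simp add: l2nrm_def)

text \<open>The same cutoff \<open>M\<close> can stand on both sides because the operators
  considered are lower triangular: entry \<open>i\<close> of the image depends only on
  \<open>f j\<close> with \<open>j \<le> i\<close>. All later estimates then concern finite
  sums.\<close>

lemma opnorm_le_triangular:
  assumes "0 \<le> c"
    and "\<And>f M. f \<in> l2 \<Longrightarrow> (\<Sum>i<M. (cmod (T f i))\<^sup>2) \<le> c\<^sup>2 * (\<Sum>j<M. (cmod (f j))\<^sup>2)"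
  shows "opnorm T \<le> ennreal c"
  unfolding opnorm_def
proof (rule SUP_least)
  fix f assume "f \<in> {f. f \<in> l2 \<and> l2nrm f \<le> 1}"
  then have f: "f \<in> l2" and sm: "summable (\<lambda>j. (cmod (f j))\<^sup>2)" and "l2nrm f \<le> 1"
    by (auto simp: l2_def)
  then have "sqrt (\<Sum>j. (cmod (f j))\<^sup>2) \<le> 1"
    by (simp add: l2nrm_def)
  then have le1: "(\<Sum>j. (cmod (f j))\<^sup>2) \<le> 1"
    by simp
  show "l2nrm (T f) \<le> ennreal c"
  proof (rule l2nrm_le[OF assms(1)])
    fix M
    have "(\<Sum>j<M. (cmod (f j))\<^sup>2) \<le> 1"
      using sum_le_suminf[OF sm, of "{..<M}"] le1 by auto
    then have "c\<^sup>2 * (\<Sum>j<M. (cmod (f j))\<^sup>2) \<le> c\<^sup>2 * 1"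
      by (intro mult_left_mono) auto
    then show "(\<Sum>i<M. (cmod (T f i))\<^sup>2) \<le> c\<^sup>2"
      using assms(2)[OF f, of M] by simp
  qed
qed

lemma cmod_le_l2_norm:
  assumes "f \<in> l2"
  shows "cmod (f j) \<le> sqrt (\<Sum>n. (cmod (f n))\<^sup>2)"
proof -
  have "(\<Sum>n\<in>{j}. (cmod (f n))\<^sup>2) \<le> (\<Sum>n. (cmod (f n))\<^sup>2)"
    by (intro sum_le_suminf) (use assms in \<open>auto simp: l2_def\<close>)
  then show ?thesis
    by (simp add: real_le_rsqrt)
qed

text \<open>Gaussian elimination by induction on the number of equations: equation \<open>n\<close>
  is solved for an unknown with nonzero coefficient, which is then substituted into the other
  equations.\<close>

lemma homogeneous_system_nontrivial_solution:
  fixes c :: "nat \<Rightarrow> 'a \<Rightarrow> 'b::field"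
  assumes "finite K" "n < card K"
  shows "\<exists>x. (\<exists>k\<in>K. x k \<noteq> 0) \<and> (\<forall>i<n. (\<Sum>k\<in>K. c i k * x k) = 0)"
  using assms
proof (induction n arbitrary: K c)
  case 0
  then obtain k where "k \<in> K"
    by (metis card_gt_0_iff equals0I)
  then show ?case
    by (intro exI[of _ "\<lambda>_. 1"]) auto
next
  case (Suc n)
  show ?case
  proof (cases "\<forall>k\<in>K. c n k = 0")
    case True
    from Suc.IH[of K c] Suc.prems obtain x where
      "\<exists>k\<in>K. x k \<noteq> 0" "\<forall>i<n. (\<Sum>k\<in>K. c i k * x k) = 0"
      by auto
    moreover have "(\<Sum>k\<in>K. c n k * x k) = 0"
      using True by simp
    ultimately show ?thesis
      by (metis less_Suc_eq)
  next
    case False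
    then obtain k0 where k0: "k0 \<in> K" "c n k0 \<noteq> 0"
      by auto
    define K' where "K' = K - {k0}"
    have K': "finite K'" "n < card K'" "k0 \<notin> K'" "K = insert k0 K'"
      using Suc.prems k0 by (auto simp: K'_def)
    \<comment> \<open>Coefficients of the remaining equations after the unknown \<open>k0\<close>
      has been eliminated by means of equation \<open>n\<close>.\<close>
    define d where "d i k = c i k - c i k0 * c n k / c n k0" for i k
    obtain x where x: "\<exists>k\<in>K'. x k \<noteq> 0" "\<forall>i<n. (\<Sum>k\<in>K'. d i k * x k) = 0"
      using Suc.IH[OF K'(1,2), of d] by auto
    define y where "y = x(k0 := - (\<Sum>k\<in>K'. c n k * x k) / c n k0)"
    have yx: "(\<Sum>k\<in>K'. c i k * y k) = (\<Sum>k\<in>K'. c i k * x k)" for i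
      by (rule sum.cong) (use K' in \<open>auto simp: y_def\<close>)
    have split: "(\<Sum>k\<in>K. c i k * y k) = (\<Sum>k\<in>K'. c i k * x k) - c i k0 / c n k0 * (\<Sum>k\<in>K'. c n k * x k)" for i
      using K' by (simp add: yx) (simp add: y_def)
    have "(\<Sum>k\<in>K. c i k * y k) = (\<Sum>k\<in>K'. d i k * x k)" for i
      unfolding split by (simp add: d_def sum_distrib_left sum_subtractf[symmetric] algebra_simps)
    moreover have "(\<Sum>k\<in>K. c n k * y k) = 0"
      unfolding split using k0 by simp
    moreover have "\<exists>k\<in>K. y k \<noteq> 0"
      using x(1) K' by (auto simp: y_def)
    ultimately show ?thesis
      using x(2) by (metis less_Suc_eq)
  qed
qed

section \<open>Linear structure of \<open>l2\<close> and kernels of operators of finite rank\<close>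

lemma l2_add: "f \<in> l2 \<Longrightarrow> g \<in> l2 \<Longrightarrow> (\<lambda>k. f k + g k) \<in> l2"
proof -
  assume "f \<in> l2" "g \<in> l2"
  then have sm: "summable (\<lambda>k. 2 * (cmod (f k))\<^sup>2 + 2 * (cmod (g k))\<^sup>2)"
    by (auto simp: l2_def intro!: summable_add summable_mult)
  have "(cmod (f k + g k))\<^sup>2 \<le> 2 * (cmod (f k))\<^sup>2 + 2 * (cmod (g k))\<^sup>2" for k
  proof -
    have "(cmod (f k + g k))\<^sup>2 \<le> (cmod (f k) + cmod (g k))\<^sup>2"
      by (intro power_mono norm_triangle_ineq) auto
    also have "\<dots> \<le> 2 * (cmod (f k))\<^sup>2 + 2 * (cmod (g k))\<^sup>2"
      using sum_squares_bound[of "cmod (f k)" "cmod (g k)"] by (simp add: power2_sum)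
    finally show ?thesis .
  qed
  then show ?thesis
    unfolding l2_def by (auto intro!: summable_comparison_test'[OF sm, of 0])
qed

lemma l2_scale: "f \<in> l2 \<Longrightarrow> (\<lambda>k. c * f k) \<in> l2"
  by (auto simp: l2_def norm_mult power_mult_distrib intro!: summable_mult)

lemma l2_sum:
  assumes "finite K" "\<And>k. k \<in> K \<Longrightarrow> e k \<in> l2"
  shows "(\<lambda>j. \<Sum>k\<in>K. x k * e k j) \<in> l2"
  using assms
proof (induction K rule: finite_induct)
  case empty
  then show ?case by (simp add: l2_def)
next
  case (insert k K)
  then have "(\<lambda>j. x k * e k j + (\<Sum>k\<in>K. x k * e k j)) \<in> l2"
    by (intro l2_add l2_scale) auto
  with insert show ?case by simp
qed

lemma finite_support_l2:
  assumes "finite {j. f j \<noteq> 0}"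
  shows "f \<in> l2"
  unfolding l2_def by (auto intro!: summable_finite[OF assms])

lemma finite_rank_le_scale:
  "finite_rank_le n P \<Longrightarrow> f \<in> l2 \<Longrightarrow> P (\<lambda>k. c * f k) = (\<lambda>k. c * P f k)"
  unfolding finite_rank_le_def by blast

lemma finite_rank_le_sum:
  assumes P: "finite_rank_le n P" and "finite K" and "\<And>k. k \<in> K \<Longrightarrow> e k \<in> l2"
  shows "P (\<lambda>j. \<Sum>k\<in>K. x k * e k j) = (\<lambda>j. \<Sum>k\<in>K. x k * P (e k) j)"
  using assms(2,3)
proof (induction K rule: finite_induct)
  case empty
  have "(\<lambda>_. 0) \<in> l2" by (simp add: l2_def)
  from finite_rank_le_scale[OF P this, of 0] show ?case by simp
next
  case (insert k K)
  have "P (\<lambda>j. x k * e k j + (\<Sum>k\<in>K. x k * e k j)) =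
      (\<lambda>j. P (\<lambda>j. x k * e k j) j + P (\<lambda>j. \<Sum>k\<in>K. x k * e k j) j)"
    using P l2_scale[of "e k" "x k"] l2_sum[of K e x] insert unfolding finite_rank_le_def by auto
  moreover have "P (\<lambda>j. x k * e k j) = (\<lambda>j. x k * P (e k) j)"
    using insert by (intro finite_rank_le_scale[OF P]) auto
  ultimately show ?case
    using insert by simp
qed

text \<open>Expanding each \<open>P (e k)\<close> in the \<open>n\<close> vectors spanning the range
  turns the kernel condition into \<open>n\<close> homogeneous equations in
  \<open>card K > n\<close> unknowns.\<close>

lemma finite_rank_le_kernel:
  assumes P: "finite_rank_le n P" and K: "finite K" "n < card K" and e: "\<And>k. k \<in> K \<Longrightarrow> e k \<in> l2"
  shows "\<exists>x. (\<exists>k\<in>K. x k \<noteq> 0) \<and> P (\<lambda>j. \<Sum>k\<in>K. x k * e k j) = (\<lambda>j. 0)"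
proof -
  obtain v where "\<forall>f\<in>l2. \<exists>c. P f = (\<lambda>k. \<Sum>i<n. c i * v i k)"
    using P unfolding finite_rank_le_def by blast
  then have "\<forall>k\<in>K. \<exists>c. P (e k) = (\<lambda>j. \<Sum>i<n. c i * v i j)"
    using e by blast
  then obtain c where c: "\<And>k. k \<in> K \<Longrightarrow> P (e k) = (\<lambda>j. \<Sum>i<n. c k i * v i j)"
    by metis
  obtain x where x: "\<exists>k\<in>K. x k \<noteq> 0" "\<forall>i<n. (\<Sum>k\<in>K. c k i * x k) = 0"
    using homogeneous_system_nontrivial_solution[OF K, of "\<lambda>i k. c k i"] by auto
  have "(\<Sum>k\<in>K. x k * P (e k) j) = 0" for j
  proof -
    have "(\<Sum>k\<in>K. x k * P (e k) j) = (\<Sum>k\<in>K. \<Sum>i<n. x k * (c k i * v i j))"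
      by (intro sum.cong) (auto simp: c sum_distrib_left)
    also have "\<dots> = (\<Sum>i<n. \<Sum>k\<in>K. x k * (c k i * v i j))"
      by (rule sum.swap)
    also have "\<dots> = (\<Sum>i<n. (\<Sum>k\<in>K. c k i * x k) * v i j)"
      by (simp add: sum_distrib_left sum_distrib_right mult_ac)
    also have "\<dots> = 0"
      using x by simp
    finally show ?thesis .
  qed
  then show ?thesis
    using x(1) finite_rank_le_sum[OF P K(1) e, where x = x] by auto
qed

section \<open>Necessity\<close>

text \<open>The tail of the test function makes its partial sums vanish beyond \<open>2 ^ (m + 3)\<close>, so that the
  images under the Rhaly operator of test functions with indices in one class modulo 3 do not interact.\<close>

definition dyadic_test :: "nat \<Rightarrow> nat \<Rightarrow> complex" where
  "dyadic_test m j =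
    indicator {2^m..<2^(m+1)} j - indicator {2^(m+2)..<2^(m+3)} j / 4"

lemma dyadic_test_eq_0:
  "j \<notin> {2^m..<2^(m+1)} \<Longrightarrow> j \<notin> {2^(m+2)..<2^(m+3)} \<Longrightarrow> dyadic_test m j = 0"
  by (simp add: dyadic_test_def)

lemma dyadic_test_l2: "dyadic_test m \<in> l2"
proof (rule finite_support_l2, rule finite_subset)
  show "{j. dyadic_test m j \<noteq> 0} \<subseteq> {2^m..<2^(m+1)} \<union> {2^(m+2)..<2^(m+3)}"
    using dyadic_test_eq_0 by blast
qed simp

lemma mod_3_eq_imp_separated:
  fixes a b :: nat
  shows "a mod 3 = b mod 3 \<Longrightarrow> a \<noteq> b \<Longrightarrow> a + 3 \<le> b \<or> b + 3 \<le> a"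
  by presburger

text \<open>The support of \<open>dyadic_test m\<close> lies in \<open>{2^m..<2^(m+3)}\<close>, and
  distinct indices in one class modulo 3 differ by at least 3.\<close>

lemma dyadic_test_disjoint:
  assumes "m mod 3 = m' mod 3" "m \<noteq> m'" "dyadic_test m j \<noteq> 0"
  shows "dyadic_test m' j = 0"
proof -
  have far: "dyadic_test a j = 0 \<or> dyadic_test b j = 0" if "a + 3 \<le> b" for a b
  proof (cases "j < 2^b")
    case True
    then show ?thesis
      using power_increasing[of b "b+2" "2::nat"] by (auto intro!: disjI2 dyadic_test_eq_0)
  next
    case False
    then have "2^(a+3) \<le> j" "2^(a+1) \<le> j"
      using that power_increasing[of "a+3" b "2::nat"] power_increasing[of "a+1" b "2::nat"] by linarith+
    then show ?thesis
      by (auto intro!: disjI1 dyadic_test_eq_0)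
  qed
  have "m + 3 \<le> m' \<or> m' + 3 \<le> m"
    using assms(1,2) by (rule mod_3_eq_imp_separated)
  then show ?thesis
    using far assms(3) by blast
qed

text \<open>The two blocks contribute at most \<open>2^m\<close> and \<open>2^(m+2) / 16\<close>,
  together 5/4 times \<open>2^m\<close>.\<close>

lemma sum_dyadic_test_norm_le: "(\<Sum>j<M. (cmod (dyadic_test m j))\<^sup>2) \<le> 2^(m+1)"
proof -
  have disj: "{2^m..<2^(m+1)} \<inter> {2^(m+2)..<2^(m+3)} = ({}::nat set)"
    by auto
  have eq: "(cmod (dyadic_test m j))\<^sup>2 =
      indicator {2^m..<2^(m+1)} j + indicator {2^(m+2)..<2^(m+3)} j / 16" for j
    using disj by (auto simp: dyadic_test_def indicator_def power2_eq_square)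
  have le: "(\<Sum>j<M. indicator A j :: real) \<le> real (card A)" if "finite A" for A :: "nat set"
    using that by (simp add: sum.If_cases indicator_def card_mono)
  have "(\<Sum>j<M. (cmod (dyadic_test m j))\<^sup>2) =
      (\<Sum>j<M. indicator {2^m..<2^(m+1)} j) + (\<Sum>j<M. indicator {2^(m+2)..<2^(m+3)} j) / 16"
    by (simp add: eq sum.distrib sum_divide_distrib)
  also have "\<dots> \<le> real (card {2^m..<(2::nat)^(m+1)}) + real (card {2^(m+2)..<(2::nat)^(m+3)}) / 16"
    by (intro add_mono divide_right_mono le) auto
  also have "\<dots> \<le> 2^(m+1)"
    by (simp add: of_nat_diff power_add)
  finally show ?thesis .
qed

lemma sum_dyadic_test:
  "(\<Sum>j\<le>i. dyadic_test m j) = of_nat (card ({2^m..<2^(m+1)} \<inter> {..i})) - of_nat (card ({2^(m+2)..<2^(m+3)} \<inter> {..i})) / 4"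
proof -
  have "(\<Sum>j\<le>i. indicator A j :: complex) = of_nat (card (A \<inter> {..i}))" for A
    by (simp add: indicator_def sum.If_cases Int_commute)
  then show ?thesis
    unfolding dyadic_test_def sum_subtractf sum_divide_distrib[symmetric] by simp
qed

text \<open>The range of \<open>i\<close> is the gap between the two blocks of the support, where
  the partial sums are constant. It is the block on which \<open>rsigma \<alpha> (m+1)\<close>
  measures the operator.\<close>

lemma sum_dyadic_test_middle:
  assumes "i \<in> {2^(m+1)..<2^(m+2)}"
  shows "(\<Sum>j\<le>i. dyadic_test m j) = 2^m"
proof -
  have "{2^m..<2^(m+1)} \<inter> {..i} = {2^m..<2^(m+1)}" "{2^(m+2)..<2^(m+3)} \<inter> {..i} = {}"
    using assms by auto
  then show ?thesis
    unfolding sum_dyadic_test by (simp add: of_nat_diff)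
qed

text \<open>The second block is four times as long as the first, so its weight \<open>-1/4\<close>
  cancels the first one exactly.\<close>

lemma sum_dyadic_test_outside:
  assumes "i < 2^m \<or> 2^(m+3) \<le> i"
  shows "(\<Sum>j\<le>i. dyadic_test m j) = 0"
  using assms
proof
  assume *: "i < 2^m"
  then have "i < 2^(m+2)"
    using power_increasing[of m "m+2" "2::nat"] by auto
  with * have "{2^m..<2^(m+1)} \<inter> {..i} = {}" "{2^(m+2)..<2^(m+3)} \<inter> {..i} = {}"
    by auto
  then show ?thesis
    unfolding sum_dyadic_test by simp
next
  assume *: "2^(m+3) \<le> i"
  then have "2^(m+1) \<le> i"
    using power_increasing[of "m+1" "m+3" "2::nat"] by auto
  with * have "{2^m..<2^(m+1)} \<inter> {..i} = {2^m..<2^(m+1)}" "{2^(m+2)..<2^(m+3)} \<inter> {..i} = {2^(m+2)..<2^(m+3)}"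
    by auto
  then show ?thesis
    unfolding sum_dyadic_test by (simp add: of_nat_diff power_add)
qed

section \<open>Lower bounds for the approximation numbers\<close>

lemma rsigma_square: "(rsigma \<alpha> k)\<^sup>2 = (\<Sum>j\<in>{2^k..<2^(k+1)}. real (j+1) * (cmod (\<alpha> j))\<^sup>2)"
  unfolding rsigma_def by (intro real_sqrt_pow2 sum_nonneg) auto

lemma rsigma_nonneg: "0 \<le> rsigma \<alpha> k"
  unfolding rsigma_def by (intro real_sqrt_ge_zero sum_nonneg) auto

lemma rsigma_square_le: "(rsigma \<alpha> k)\<^sup>2 \<le> 2^(k+1) * (\<Sum>j\<in>{2^k..<2^(k+1)}. (cmod (\<alpha> j))\<^sup>2)"
  unfolding rsigma_square sum_distrib_left
proof (intro sum_mono mult_right_mono)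
  fix j assume "j \<in> {2^k..<(2::nat)^(k+1)}"
  then have "j + 1 \<le> 2^(k+1)" by simp
  then have "real (j + 1) \<le> real (2^(k+1))" by (simp only: of_nat_le_iff)
  then show "real (j + 1) \<le> 2^(k+1)" by simp
qed auto

text \<open>Any \<open>P\<close> of rank at most \<open>n < card K\<close> kills a nontrivial
  combination \<open>f\<close> of test functions, so the error of \<open>P\<close> at
  \<open>f\<close> is \<open>rhaly \<alpha> f\<close> itself. Restricted to the gap blocks, this
  image splits into independent pieces, one for each index in \<open>K\<close>.\<close>

lemma approx_num_rhaly_ge:
  assumes K: "finite K" "n < card K" and r: "\<And>m. m \<in> K \<Longrightarrow> m mod 3 = r"
    and s: "0 \<le> s" "\<And>m. m \<in> K \<Longrightarrow> s \<le> rsigma \<alpha> (m+1)"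
  shows "ennreal (s / 3) \<le> approx_num (rhaly \<alpha>) n"
  unfolding approx_num_def
proof (rule INF_greatest)
  fix P assume "P \<in> {P. finite_rank_le n P}"
  then obtain y where y: "\<exists>k\<in>K. y k \<noteq> 0" "P (\<lambda>j. \<Sum>k\<in>K. y k * dyadic_test k j) = (\<lambda>j. 0)"
    and P: "finite_rank_le n P"
    using finite_rank_le_kernel[of n P K dyadic_test] K dyadic_test_l2 by auto
  \<comment> \<open>By disjointness of supports, \<open>Z\<close> bounds the squared norm of the
    combination with coefficients \<open>y\<close>. Dividing by \<open>sqrt Z\<close> therefore
    brings \<open>f\<close> into the unit ball.\<close>
  define Z where "Z = (\<Sum>k\<in>K. (cmod (y k))\<^sup>2 * 2^(k+1))"
  have Z: "Z > 0"
    unfolding Z_def using y(1) K(1) by (auto intro!: sum_pos2)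
  define x where "x k = y k / complex_of_real (sqrt Z)" for k
  define f where "f j = (\<Sum>k\<in>K. x k * dyadic_test k j)" for j
  have x1: "(\<Sum>k\<in>K. (cmod (x k))\<^sup>2 * 2^(k+1)) = 1"
    using Z by (simp add: x_def norm_divide power_divide Z_def sum_divide_distrib[symmetric])
  have f_l2: "f \<in> l2"
    unfolding f_def by (intro l2_sum K dyadic_test_l2)
  have f_scale: "f = (\<lambda>j. (1 / complex_of_real (sqrt Z)) * (\<Sum>k\<in>K. y k * dyadic_test k j))"
    by (simp add: fun_eq_iff f_def x_def sum_divide_distrib)
  have "(\<lambda>j. \<Sum>k\<in>K. y k * dyadic_test k j) \<in> l2"
    by (intro l2_sum K dyadic_test_l2)
  then have Pf: "P f = (\<lambda>j. 0)"
    unfolding f_scale by (subst finite_rank_le_scale[OF P]) (auto simp: y(2))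
  \<comment> \<open>At each \<open>j\<close> at most one test function is nonzero, so there are no
    cross terms.\<close>
  have f_sq: "(cmod (f j))\<^sup>2 = (\<Sum>k\<in>K. (cmod (x k))\<^sup>2 * (cmod (dyadic_test k j))\<^sup>2)" for j
  proof (cases "\<exists>k\<in>K. dyadic_test k j \<noteq> 0")
    case True
    then obtain k where k: "k \<in> K" "dyadic_test k j \<noteq> 0" by auto
    have 0: "dyadic_test m j = 0" if "m \<in> K - {k}" for m
      using that k r dyadic_test_disjoint[of k m j] by auto
    show ?thesis
      using k 0 by (simp add: f_def sum.remove[OF K(1) k(1)] norm_mult power_mult_distrib)
  qed (simp add: f_def)
  have "l2nrm f \<le> ennreal 1"
  proof (rule l2nrm_le)
    fix M
    have "(\<Sum>j<M. (cmod (f j))\<^sup>2) = (\<Sum>k\<in>K. (cmod (x k))\<^sup>2 * (\<Sum>j<M. (cmod (dyadic_test k j))\<^sup>2))"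
      unfolding f_sq sum_distrib_left by (rule sum.swap)
    also have "\<dots> \<le> (\<Sum>k\<in>K. (cmod (x k))\<^sup>2 * 2^(k+1))"
      by (intro sum_mono mult_left_mono sum_dyadic_test_norm_le) auto
    finally show "(\<Sum>j<M. (cmod (f j))\<^sup>2) \<le> 1\<^sup>2"
      using x1 by simp
  qed simp
  then have "l2nrm (\<lambda>k. rhaly \<alpha> f k - P f k) \<le> opnorm (\<lambda>f k. rhaly \<alpha> f k - P f k)"
    unfolding opnorm_def using f_l2 by (intro SUP_upper) auto
  moreover have "ennreal (s / 3) \<le> l2nrm (rhaly \<alpha> f)"
  proof -
    define I where "I m = {2^(m+1)..<(2::nat)^(m+2)}" for m
    \<comment> \<open>The gap block of \<open>m\<close> avoids \<open>{2^k..<2^(k+3)}\<close>, the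
      only range where the partial sums of \<open>dyadic_test k\<close> can be nonzero.\<close>
    have sep: "i < 2^k \<or> 2^(k+3) \<le> i" if "i \<in> I m" "m \<in> K" "k \<in> K" "k \<noteq> m" for i m k
    proof -
      have "m mod 3 = k mod 3"
        using r that by simp
      then have "m + 3 \<le> k \<or> k + 3 \<le> m"
        using \<open>k \<noteq> m\<close> by (intro mod_3_eq_imp_separated) auto
      then have "(2::nat)^(m+2) \<le> 2^k \<or> (2::nat)^(k+3) \<le> 2^(m+1)"
        by (elim disjE) (simp_all del: power_Suc)
      then show ?thesis
        using that(1) unfolding I_def atLeastLessThan_iff by linarith
    qed
    have Sf: "(\<Sum>j\<le>i. f j) = x m * 2^m" if "i \<in> I m" "m \<in> K" for i m
    proof -
      have "(\<Sum>j\<le>i. f j) = (\<Sum>k\<in>K. x k * (\<Sum>j\<le>i. dyadic_test k j))"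
        unfolding f_def sum_distrib_left by (rule sum.swap)
      also have "\<dots> = x m * (\<Sum>j\<le>i. dyadic_test m j) + (\<Sum>k\<in>K-{m}. x k * (\<Sum>j\<le>i. dyadic_test k j))"
        by (rule sum.remove[OF K(1) that(2)])
      also have "(\<Sum>k\<in>K-{m}. x k * (\<Sum>j\<le>i. dyadic_test k j)) = 0"
        using sep[OF that] by (intro sum.neutral) (auto simp: sum_dyadic_test_outside)
      finally show ?thesis
        using sum_dyadic_test_middle[of i m] that(1) by (simp add: I_def)
    qed
    have disj: "I m \<inter> I k = {}" if "m \<in> K" "k \<in> K" "m \<noteq> k" for m k
    proof -
      have "m + 2 \<le> k + 1 \<or> k + 2 \<le> m + 1"
        using that(3) by linarith
      then have "(2::nat)^(m+2) \<le> 2^(k+1) \<or> (2::nat)^(k+2) \<le> 2^(m+1)"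
        using power_increasing[of "m+2" "k+1" "2::nat"] power_increasing[of "k+2" "m+1" "2::nat"] by linarith
      then show ?thesis
        unfolding I_def disjoint_iff atLeastLessThan_iff by linarith
    qed
    have "(s/3)\<^sup>2 * (\<Sum>m\<in>K. (cmod (x m))\<^sup>2 * 2^(m+1)) \<le>
        (\<Sum>m\<in>K. \<Sum>i\<in>I m. (cmod (rhaly \<alpha> f i))\<^sup>2)"
      unfolding sum_distrib_left
    proof (rule sum_mono)
      fix m assume m: "m \<in> K"
      define A where "A = (\<Sum>i\<in>I m. (cmod (\<alpha> i))\<^sup>2)"
      have "s\<^sup>2 \<le> (rsigma \<alpha> (m+1))\<^sup>2"
        using s m by (intro power_mono) auto
      also have "\<dots> \<le> 2^(m+2) * A"
        using rsigma_square_le[of \<alpha> "m+1"] by (simp add: A_def I_def)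
      finally have sA: "s\<^sup>2 \<le> 2^(m+2) * A" .
      have four: "(2::real)^m * 2^m = 4^m"
        by (simp add: power_mult_distrib[symmetric])
      have "(\<Sum>i\<in>I m. (cmod (rhaly \<alpha> f i))\<^sup>2) = (\<Sum>i\<in>I m. (cmod (\<alpha> i))\<^sup>2 * ((cmod (x m))\<^sup>2 * 4^m))"
        by (intro sum.cong) (auto simp: rhaly_def Sf m norm_mult norm_power power2_eq_square four[symmetric])
      also have "\<dots> = A * ((cmod (x m))\<^sup>2 * 4^m)"
        by (simp add: A_def sum_distrib_right)
      finally have eq: "(\<Sum>i\<in>I m. (cmod (rhaly \<alpha> f i))\<^sup>2) = A * ((cmod (x m))\<^sup>2 * 4^m)" .
      \<comment> \<open>Inserting the bound \<open>sA\<close> produces the factor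
        \<open>2^(m+2) * 2^(m+1) / 9\<close>, that is 8/9 times \<open>4^m\<close>. The constant 3
        in the lower bound is chosen because its square exceeds 8.\<close>
      have "(s/3)\<^sup>2 * ((cmod (x m))\<^sup>2 * 2^(m+1)) = s\<^sup>2 * ((cmod (x m))\<^sup>2 * 2^(m+1) / 9)"
        by (simp add: power2_eq_square)
      also have "\<dots> \<le> (2^(m+2) * A) * ((cmod (x m))\<^sup>2 * 2^(m+1) / 9)"
        by (intro mult_right_mono sA) auto
      also have "\<dots> = (8/9) * (A * ((cmod (x m))\<^sup>2 * (2^m * 2^m)))"
        by simp
      also note four
      also have "(8/9) * (A * ((cmod (x m))\<^sup>2 * 4^m)) \<le> 1 * (A * ((cmod (x m))\<^sup>2 * 4^m))"
        by (intro mult_right_mono mult_nonneg_nonneg) (auto simp: A_def intro!: sum_nonneg)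
      finally show "(s/3)\<^sup>2 * ((cmod (x m))\<^sup>2 * 2^(m+1)) \<le> (\<Sum>i\<in>I m. (cmod (rhaly \<alpha> f i))\<^sup>2)"
        unfolding eq by simp
    qed
    also have "\<dots> = (\<Sum>i\<in>(\<Union>m\<in>K. I m). (cmod (rhaly \<alpha> f i))\<^sup>2)"
      using K disj by (intro sum.UNION_disjoint[symmetric]) (auto simp: I_def)
    finally have "s / 3 \<le> sqrt (\<Sum>i\<in>(\<Union>m\<in>K. I m). (cmod (rhaly \<alpha> f i))\<^sup>2)"
      unfolding x1 by (intro real_le_rsqrt) simp
    then have "ennreal (s / 3) \<le> ennreal (sqrt (\<Sum>i\<in>(\<Union>m\<in>K. I m). (cmod (rhaly \<alpha> f i))\<^sup>2))"
      by (rule ennreal_leI)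
    also have "\<dots> \<le> l2nrm (rhaly \<alpha> f)"
      by (rule l2nrm_ge) (use K in \<open>auto simp: I_def\<close>)
    finally show ?thesis .
  qed
  ultimately show "ennreal (s / 3) \<le> opnorm (\<lambda>f k. rhaly \<alpha> f k - P f k)"
    using Pf by (simp cong: if_cong)
qed

text \<open>The smallest of the \<open>card F\<close> values is controlled by the approximation number with the
  largest index, which drives an induction without sorting the values.\<close>

lemma sum_rsigma_powr_le:
  assumes fin: "\<And>n. approx_num (rhaly \<alpha>) n < \<infinity>" and "0 < q"
    and "finite F" "\<And>m. m \<in> F \<Longrightarrow> m mod 3 = r"
  shows "(\<Sum>m\<in>F. rsigma \<alpha> (m+1) powr q) \<le> 3 powr q * (\<Sum>n<card F. enn2real (approx_num (rhaly \<alpha>) n) powr q)"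
  using assms(3,4)
proof (induction "card F" arbitrary: F)
  case 0
  then show ?case by simp
next
  case (Suc N)
  then have "F \<noteq> {}" by auto
  define h where "h m = rsigma \<alpha> (m+1)" for m
  obtain m0 where m0: "m0 \<in> F" "\<And>m. m \<in> F \<Longrightarrow> h m0 \<le> h m"
    using \<open>finite F\<close> \<open>F \<noteq> {}\<close> ex_min_if_finite[of "h ` F"] by (auto simp: not_less)
  \<comment> \<open>All \<open>Suc N\<close> indices of \<open>F\<close> satisfy the lower bound
    \<open>h m0\<close>, which is one more than rank \<open>N\<close> can annihilate.\<close>
  have "ennreal (h m0 / 3) \<le> approx_num (rhaly \<alpha>) N"
    using m0 Suc by (intro approx_num_rhaly_ge[of F _ r]) (auto simp: h_def rsigma_nonneg)
  then have "enn2real (ennreal (h m0 / 3)) \<le> enn2real (approx_num (rhaly \<alpha>) N)"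
    using fin[of N] by (intro enn2real_mono) auto
  then have "h m0 \<le> 3 * enn2real (approx_num (rhaly \<alpha>) N)"
    by (simp add: h_def rsigma_nonneg)
  then have "h m0 powr q \<le> (3 * enn2real (approx_num (rhaly \<alpha>) N)) powr q"
    using \<open>0 < q\<close> by (intro powr_mono2) (auto simp: h_def rsigma_nonneg)
  then have 1: "h m0 powr q \<le> 3 powr q * enn2real (approx_num (rhaly \<alpha>) N) powr q"
    by (simp add: powr_mult)
  have c: "card (F - {m0}) = N"
    using Suc m0 by simp
  have "(\<Sum>m\<in>F-{m0}. h m powr q) \<le> 3 powr q * (\<Sum>n<N. enn2real (approx_num (rhaly \<alpha>) n) powr q)"
    using Suc.hyps(1)[of "F - {m0}"] Suc.prems c by (simp add: h_def)
  with 1 show ?case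
    unfolding Suc.hyps(2)[symmetric]
    using sum.remove[OF \<open>finite F\<close> m0(1), of "\<lambda>m. h m powr q"] by (simp add: h_def algebra_simps)
qed

text \<open>The indices are split into residue classes modulo 3. In each class the finite sums are
  bounded by the same convergent series of approximation numbers.\<close>

lemma summable_rsigma_seq_if_schatten:
  assumes "schatten q (rhaly \<alpha>)" "0 < q"
  shows "summable (\<lambda>k. rsigma_seq \<alpha> k powr q)"
proof -
  define a where "a n = enn2real (approx_num (rhaly \<alpha>) n) powr q" for n
  have fin: "approx_num (rhaly \<alpha>) n < \<infinity>" for n
    using assms by (simp add: schatten_def)
  have sm: "summable a"
    using assms unfolding schatten_def a_def by blast
  have "summable (\<lambda>m. rsigma \<alpha> (m+1) powr q)"
  proof (rule summableI_nonneg_bounded)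
    fix M
    have "(\<Sum>m<M. rsigma \<alpha> (m+1) powr q) =
        (\<Sum>r<3. \<Sum>m\<in>{m. m \<in> {..<M} \<and> m mod 3 = r}. rsigma \<alpha> (m+1) powr q)"
      by (rule sum.group[symmetric]) auto
    also have "\<dots> \<le> (\<Sum>r<(3::nat). 3 powr q * suminf a)"
    proof (rule sum_mono)
      fix r :: nat
      let ?F = "{m. m \<in> {..<M} \<and> m mod 3 = r}"
      have "(\<Sum>m\<in>?F. rsigma \<alpha> (m+1) powr q) \<le> 3 powr q * sum a {..<card ?F}"
        unfolding a_def by (rule sum_rsigma_powr_le[OF fin assms(2)]) auto
      also have "\<dots> \<le> 3 powr q * suminf a"
        by (intro mult_left_mono sum_le_suminf sm) (auto simp: a_def)
      finally show "(\<Sum>m\<in>?F. rsigma \<alpha> (m+1) powr q) \<le> 3 powr q * suminf a" .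
    qed
    finally show "(\<Sum>m<M. rsigma \<alpha> (m+1) powr q) \<le> (\<Sum>r<(3::nat). 3 powr q * suminf a)" .
  qed simp
  \<comment> \<open>The test functions see the blocks from \<open>rsigma \<alpha> 1\<close> onwards,
    which is index 2 of the shifted sequence. The two missing terms do not affect
    summability.\<close>
  then have "summable (\<lambda>k. rsigma_seq \<alpha> (k + 2) powr q)"
    by (simp add: rsigma_seq_def)
  then show ?thesis
    by (subst (asm) summable_iff_shift)
qed

section \<open>Hardy-type inequalities\<close>

lemma sum_inverse_sqrt_le: "(\<Sum>j\<le>i. 1 / sqrt (real (j+1))) \<le> 2 * sqrt (real (i+1))"
proof (induction i)
  case (Suc i)
  define a b where "a = sqrt (real (i+1))" and "b = sqrt (real (i+2))"
  have ab: "a \<ge> 0" "b > 0" "b\<^sup>2 = a\<^sup>2 + 1"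
    by (auto simp: a_def b_def)
  \<comment> \<open>Expanding the square and using that \<open>b\<close> squared minus
    \<open>a\<close> squared is 1 bounds the new term \<open>1 / b\<close> by the increment
    \<open>2 * (b - a)\<close>.\<close>
  have "0 \<le> (b - a)\<^sup>2" by simp
  then have "1 \<le> 2 * (b - a) * b"
    using ab by (simp add: power2_eq_square algebra_simps)
  then have "1 / b \<le> 2 * (b - a)"
    using ab by (simp add: divide_le_eq)
  with Suc show ?case
    by (simp add: a_def b_def algebra_simps)
qed simp

text \<open>Cauchy--Schwarz with the weights \<open>(j + 1) powr (1/4)\<close>, the classical choice in Hardy's inequality.\<close>

lemma norm_sum_square_le_weighted:
  fixes f :: "nat \<Rightarrow> complex"
  shows "(cmod (\<Sum>j\<le>i. f j))\<^sup>2 \<le> 2 * sqrt (real (i+1)) * (\<Sum>j\<le>i. sqrt (real (j+1)) * (cmod (f j))\<^sup>2)"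
proof -
  define u where "u j = sqrt (sqrt (real (j+1)))" for j
  have u: "u j > 0" "(u j)\<^sup>2 = sqrt (real (j+1))" for j
    by (auto simp: u_def)
  have "(cmod (\<Sum>j\<le>i. f j))\<^sup>2 \<le> (\<Sum>j\<le>i. cmod (f j))\<^sup>2"
    by (intro power_mono norm_sum) auto
  also have "(\<Sum>j\<le>i. cmod (f j)) = (\<Sum>j\<le>i. (1 / u j) * (u j * cmod (f j)))"
    using u(1) by (intro sum.cong) (auto simp: less_imp_neq[symmetric])
  also have "(\<dots>)\<^sup>2 \<le> (\<Sum>j\<le>i. (1 / u j)\<^sup>2) * (\<Sum>j\<le>i. (u j * cmod (f j))\<^sup>2)"
    by (rule Cauchy_Schwarz_ineq_sum)
  also have "\<dots> = (\<Sum>j\<le>i. 1 / sqrt (real (j+1))) * (\<Sum>j\<le>i. sqrt (real (j+1)) * (cmod (f j))\<^sup>2)"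
    by (simp add: power_divide power_mult_distrib u(2))
  also have "\<dots> \<le> 2 * sqrt (real (i+1)) * (\<Sum>j\<le>i. sqrt (real (j+1)) * (cmod (f j))\<^sup>2)"
    by (intro mult_right_mono sum_inverse_sqrt_le sum_nonneg) auto
  finally show ?thesis .
qed

lemma sum_triangle_swap:
  fixes g :: "nat \<Rightarrow> nat \<Rightarrow> 'a::comm_monoid_add"
  shows "(\<Sum>i<M. \<Sum>j\<le>i. g i j) = (\<Sum>j<M. \<Sum>i=j..<M. g i j)"
proof -
  have "(\<Sum>i<M. \<Sum>j\<le>i. g i j) = (\<Sum>i<M. \<Sum>j\<in>{j. j \<in> {..<M} \<and> j \<le> i}. g i j)"
    by (intro sum.cong) auto
  also have "\<dots> = (\<Sum>j<M. \<Sum>i\<in>{i. i \<in> {..<M} \<and> j \<le> i}. g i j)"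
    by (rule sum.swap_restrict) auto
  also have "\<dots> = (\<Sum>j<M. \<Sum>i=j..<M. g i j)"
    by (intro sum.cong) auto
  finally show ?thesis .
qed

text \<open>On block \<open>L\<close> the weight \<open>sqrt (i+1)\<close> is at most
  \<open>(i+1) / sqrt (2^L)\<close>, so the block contributes at most \<open>B / sqrt (2^L)\<close>.
  The geometric series is stated as a telescoping difference so that the induction on
  \<open>L\<close> closes.\<close>

lemma dyadic_tail_le:
  fixes w :: "nat \<Rightarrow> real"
  assumes w: "\<And>i. 0 \<le> w i" and B: "\<And>k. (\<Sum>i\<in>{2^k..<2^(k+1)}. real (i+1) * w i) \<le> B" and "K \<le> L"
  shows "(\<Sum>i\<in>{2^K..<2^L}. sqrt (real (i+1)) * w i) \<le> 4 * B * (1 / sqrt (2^K) - 1 / sqrt (2^L))"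
  using \<open>K \<le> L\<close>
proof (induction L rule: dec_induct)
  case (step L)
  have B0: "0 \<le> B"
    using B[of 0] w by (intro order_trans[OF _ B[of 0]] sum_nonneg) auto
  have "(2::nat)^K \<le> 2^L"
    using step by (intro power_increasing) auto
  then have "(\<Sum>i\<in>{2^K..<2^Suc L}. sqrt (real (i+1)) * w i) =
      (\<Sum>i\<in>{2^K..<2^L}. sqrt (real (i+1)) * w i) + (\<Sum>i\<in>{2^L..<2^Suc L}. sqrt (real (i+1)) * w i)"
    by (intro sum.atLeastLessThan_concat[symmetric]) auto
  moreover have "(\<Sum>i\<in>{2^L..<2^Suc L}. sqrt (real (i+1)) * w i) \<le>
      (\<Sum>i\<in>{2^L..<2^Suc L}. real (i+1) * w i / sqrt (2^L))"
  proof (rule sum_mono)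
    fix i assume "i \<in> {2^L..<(2::nat)^Suc L}"
    then have "2^L \<le> i + 1" by simp
    then have "real (2^L) \<le> real (i+1)" by (simp only: of_nat_le_iff)
    then have "sqrt (2^L) \<le> sqrt (real (i+1))" by simp
    then have "sqrt (real (i+1)) * sqrt (2^L) \<le> sqrt (real (i+1)) * sqrt (real (i+1))"
      by (rule mult_left_mono) simp
    then have "sqrt (real (i+1)) * sqrt (2^L) \<le> real (i+1)"
      by simp
    then have "sqrt (real (i+1)) \<le> real (i+1) / sqrt (2^L)"
      by (simp add: le_divide_eq)
    then show "sqrt (real (i+1)) * w i \<le> real (i+1) * w i / sqrt (2^L)"
      using mult_right_mono[OF _ w[of i]] by fastforce
  qed
  moreover have "(\<Sum>i\<in>{2^L..<2^Suc L}. real (i+1) * w i / sqrt (2^L)) \<le> B / sqrt (2^L)"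
    unfolding sum_divide_distrib[symmetric] using B[of L] by (intro divide_right_mono) auto
  \<comment> \<open>The factor 4 suffices because \<open>sqrt 2 \<ge> 4/3\<close>, hence
    \<open>4 * (1 - 1 / sqrt 2) \<ge> 1\<close>.\<close>
  moreover have "B / sqrt (2^L) \<le> 4 * B * (1 / sqrt (2^L) - 1 / sqrt (2^Suc L))"
  proof -
    have s2: "4 / 3 \<le> sqrt (2::real)"
      by (intro real_le_rsqrt) (simp add: power2_eq_square)
    have "1 / sqrt (2^Suc L) = 1 / sqrt (2^L) * (1 / sqrt 2)"
      by (simp add: real_sqrt_mult)
    also have "\<dots> \<le> 1 / sqrt (2^L) * (3 / 4)"
      using s2 by (intro mult_left_mono) (auto simp: field_simps)
    finally have "1 / sqrt (2^L) \<le> 4 * (1 / sqrt (2^L) - 1 / sqrt (2^Suc L))"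
      by simp
    from mult_left_mono[OF this B0] show ?thesis
      by (simp add: algebra_simps)
  qed
  ultimately show ?case
    using step.IH by (simp add: algebra_simps)
qed simp

text \<open>For \<open>j > 0\<close> the tail is extended down to the dyadic point
  \<open>2^K \<le> j\<close>; the loss, at most \<open>sqrt 2 \<le> 3/2\<close>, turns 4 into 6. The
  index 0 belongs to no block \<open>{2^k..<2^(k+1)}\<close>, which is why \<open>w 0\<close> is
  bounded separately.\<close>

lemma weighted_tail_le:
  fixes w :: "nat \<Rightarrow> real"
  assumes w: "\<And>i. 0 \<le> w i" and B: "\<And>k. (\<Sum>i\<in>{2^k..<2^(k+1)}. real (i+1) * w i) \<le> B" and w0: "w 0 \<le> B"
  shows "(\<Sum>i=j..<M. sqrt (real (i+1)) * w i) \<le> 6 * B / sqrt (real (j+1))"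
proof -
  have B0: "0 \<le> B"
    using w0 w[of 0] by linarith
  have dyadic: "(\<Sum>i=2^K..<M. sqrt (real (i+1)) * w i) \<le> 4 * B / sqrt (2^K)" for K
  proof -
    have "M \<le> 2^(M+K)"
      using less_exp[of "M+K"] by linarith
    then have "(\<Sum>i=2^K..<M. sqrt (real (i+1)) * w i) \<le> (\<Sum>i\<in>{2^K..<2^(M+K)}. sqrt (real (i+1)) * w i)"
      using w by (intro sum_mono2) auto
    also have "\<dots> \<le> 4 * B * (1 / sqrt (2^K) - 1 / sqrt (2^(M+K)))"
      by (rule dyadic_tail_le[OF w B]) auto
    also have "\<dots> \<le> 4 * B * (1 / sqrt (2^K))"
      using B0 by (intro mult_left_mono) auto
    finally show ?thesis by simp
  qed
  show ?thesis
  proof (cases "j = 0")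
    case True
    have "(\<Sum>i=0..<M. sqrt (real (i+1)) * w i) \<le> (\<Sum>i\<in>insert 0 {1..<M}. sqrt (real (i+1)) * w i)"
      using w by (intro sum_mono2) auto
    also have "\<dots> \<le> B + 4 * B"
      using dyadic[of 0] w0 by simp
    finally show ?thesis
      using True B0 by simp
  next
    case False
    then obtain K where K: "2^K \<le> j" "j < 2^(K+1)"
      using ex_power_ivl1[of 2 j] by auto
    then have "j + 1 \<le> 2 * 2^K" by simp
    then have "real (j+1) \<le> real (2 * 2^K)" by (simp only: of_nat_le_iff)
    then have "sqrt (real (j+1)) \<le> sqrt (2 * 2^K)" by simp
    also have "\<dots> \<le> 3/2 * sqrt (2^K)"
      unfolding real_sqrt_mult
      by (intro mult_right_mono real_le_lsqrt) (auto simp: power2_eq_square)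
    finally have "1 / sqrt (2^K) \<le> (3/2) / sqrt (real (j+1))"
      by (simp add: field_simps)
    from mult_left_mono[OF this, of "4 * B"] have "4 * B / sqrt (2^K) \<le> 6 * B / sqrt (real (j+1))"
      using B0 by simp
    moreover have "(\<Sum>i=j..<M. sqrt (real (i+1)) * w i) \<le> (\<Sum>i=2^K..<M. sqrt (real (i+1)) * w i)"
      using w K by (intro sum_mono2) auto
    ultimately show ?thesis
      using dyadic[of K] by linarith
  qed
qed

text \<open>After the weighted Cauchy-Schwarz estimate and an interchange of sums, the tail bound
  cancels the weight \<open>sqrt (j+1)\<close>. The constant is 2 times 6.\<close>

lemma dyadic_hardy_inequality:
  fixes w :: "nat \<Rightarrow> real" and f :: "nat \<Rightarrow> complex"
  assumes w: "\<And>i. 0 \<le> w i" and B: "\<And>k. (\<Sum>i\<in>{2^k..<2^(k+1)}. real (i+1) * w i) \<le> B" and w0: "w 0 \<le> B"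
  shows "(\<Sum>i<M. w i * (cmod (\<Sum>j\<le>i. f j))\<^sup>2) \<le> 12 * B * (\<Sum>j<M. (cmod (f j))\<^sup>2)"
proof -
  have "(\<Sum>i<M. w i * (cmod (\<Sum>j\<le>i. f j))\<^sup>2) \<le>
      (\<Sum>i<M. w i * (2 * sqrt (real (i+1)) * (\<Sum>j\<le>i. sqrt (real (j+1)) * (cmod (f j))\<^sup>2)))"
    by (intro sum_mono mult_left_mono norm_sum_square_le_weighted w)
  also have "\<dots> = (\<Sum>i<M. \<Sum>j\<le>i. 2 * sqrt (real (j+1)) * (cmod (f j))\<^sup>2 * (sqrt (real (i+1)) * w i))"
    by (simp add: sum_distrib_left mult_ac)
  also have "\<dots> = (\<Sum>j<M. 2 * sqrt (real (j+1)) * (cmod (f j))\<^sup>2 * (\<Sum>i=j..<M. sqrt (real (i+1)) * w i))"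
    by (subst sum_triangle_swap) (simp add: sum_distrib_left)
  also have "\<dots> \<le> (\<Sum>j<M. 2 * sqrt (real (j+1)) * (cmod (f j))\<^sup>2 * (6 * B / sqrt (real (j+1))))"
    by (intro sum_mono mult_left_mono weighted_tail_le[OF w B w0]) auto
  also have "\<dots> = 12 * B * (\<Sum>j<M. (cmod (f j))\<^sup>2)"
    by (simp add: sum_distrib_left field_simps)
  finally show ?thesis .
qed

text \<open>Here \<open>p i\<close> is the left end of the interval containing \<open>i\<close>, and
  the second hypothesis says that this end is constant along the interval. Cauchy-Schwarz costs the
  length \<open>i - p i\<close>; after interchanging the sums, only indices \<open>i\<close> of one
  interval meet a given \<open>j\<close>.\<close>

lemma piecewise_sum_inequality:
  fixes w :: "nat \<Rightarrow> real" and f :: "nat \<Rightarrow> complex" and p :: "nat \<Rightarrow> nat"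
  assumes w: "\<And>i. 0 \<le> w i"
    and p: "\<And>i j. p i < j \<Longrightarrow> j \<le> i \<Longrightarrow> p j = p i"
    and B: "\<And>i. real (i - p i) * (\<Sum>l\<in>{p i<..i}. w l) \<le> B"
  shows "(\<Sum>i<M. w i * (cmod (\<Sum>j\<in>{p i<..i}. f j))\<^sup>2) \<le> B * (\<Sum>j<M. (cmod (f j))\<^sup>2)"
proof -
  have "0 \<le> real (0 - p 0) * (\<Sum>l\<in>{p 0<..0}. w l)"
    by simp
  then have B0: "0 \<le> B"
    using B[of 0] by linarith
  have "(\<Sum>i<M. w i * (cmod (\<Sum>j\<in>{p i<..i}. f j))\<^sup>2) \<le>
      (\<Sum>i<M. w i * ((\<Sum>j\<in>{p i<..i}. (cmod (f j))\<^sup>2) * real (i - p i)))"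
  proof (intro sum_mono mult_left_mono w)
    fix i
    have "(cmod (\<Sum>j\<in>{p i<..i}. f j))\<^sup>2 \<le> (\<Sum>j\<in>{p i<..i}. cmod (f j))\<^sup>2"
      by (intro power_mono norm_sum) auto
    also have "\<dots> \<le> (\<Sum>j\<in>{p i<..i}. (cmod (f j))\<^sup>2) * real (i - p i)"
      using sum_squared_le_sum_of_squares[of "\<lambda>j. cmod (f j)" "{p i<..i}"] by simp
    finally show "(cmod (\<Sum>j\<in>{p i<..i}. f j))\<^sup>2 \<le> (\<Sum>j\<in>{p i<..i}. (cmod (f j))\<^sup>2) * real (i - p i)" .
  qed
  also have "\<dots> = (\<Sum>i<M. \<Sum>j\<in>{j. j \<in> {..<M} \<and> p i < j \<and> j \<le> i}. (cmod (f j))\<^sup>2 * (w i * real (i - p i)))"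
  proof (intro sum.cong refl)
    fix i assume "i \<in> {..<M}"
    then have "{p i<..i} = {j. j \<in> {..<M} \<and> p i < j \<and> j \<le> i}" by auto
    then show "w i * ((\<Sum>j\<in>{p i<..i}. (cmod (f j))\<^sup>2) * real (i - p i)) =
        (\<Sum>j\<in>{j. j \<in> {..<M} \<and> p i < j \<and> j \<le> i}. (cmod (f j))\<^sup>2 * (w i * real (i - p i)))"
      by (simp add: sum_distrib_left sum_distrib_right mult_ac)
  qed
  also have "\<dots> = (\<Sum>j<M. \<Sum>i\<in>{i. i \<in> {..<M} \<and> p i < j \<and> j \<le> i}. (cmod (f j))\<^sup>2 * (w i * real (i - p i)))"
    by (rule sum.swap_restrict) auto
  also have "\<dots> = (\<Sum>j<M. (cmod (f j))\<^sup>2 * (\<Sum>i\<in>{i. i \<in> {..<M} \<and> p i < j \<and> j \<le> i}. w i * real (i - p i)))"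
    by (simp add: sum_distrib_left)
  also have "\<dots> \<le> (\<Sum>j<M. (cmod (f j))\<^sup>2 * B)"
  proof (intro sum_mono mult_left_mono)
    fix j
    define I where "I = {i. i \<in> {..<M} \<and> p i < j \<and> j \<le> i}"
    show "(\<Sum>i\<in>I. w i * real (i - p i)) \<le> B"
    proof (cases "I = {}")
      case True
      then show ?thesis using B0 by simp
    next
      case False
      have fin: "finite I" by (auto simp: I_def)
      \<comment> \<open>The largest contributing index has the greatest length
        \<open>m - p m\<close>, and \<open>{p m<..m}\<close> contains all other contributing
        indices.\<close>
      define m where "m = Max I"
      have m: "m \<in> I" "\<And>i. i \<in> I \<Longrightarrow> i \<le> m"
        using False fin by (auto simp: m_def)
      have pI: "p i = p j" if "i \<in> I" for i
        using that p[of i j] by (auto simp: I_def)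
      have "(\<Sum>i\<in>I. w i * real (i - p i)) \<le> (\<Sum>i\<in>I. w i * real (m - p m))"
        using m pI by (intro sum_mono mult_left_mono w) (auto intro!: diff_le_mono)
      also have "\<dots> = real (m - p m) * (\<Sum>i\<in>I. w i)"
        unfolding sum_distrib_left by (intro sum.cong) auto
      also have "\<dots> \<le> real (m - p m) * (\<Sum>i\<in>{p m<..m}. w i)"
      proof (intro mult_left_mono sum_mono2 w)
        show "I \<subseteq> {p m<..m}"
        proof
          fix i assume i: "i \<in> I"
          have "p m < j" "j \<le> i"
            using m(1) i by (auto simp: I_def)
          then show "i \<in> {p m<..m}"
            using m(2)[OF i] by simp
        qed
      qed auto
      also have "\<dots> \<le> B" by (rule B)
      finally show ?thesis .
    qed
  qed auto
  finally show ?thesis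
    by (simp add: sum_distrib_left mult_ac)
qed

text \<open>Labels are the integer parts of a cumulative mass that charges length and weight equally.\<close>

lemma ex_balanced_labelling:
  fixes w :: "nat \<Rightarrow> real"
  assumes w: "\<And>i. 0 \<le> w i" and ts: "0 < t" "t \<le> s" and ab: "a < b"
    and mass: "real (b - a) * (\<Sum>i\<in>{a..<b}. w i) \<le> s\<^sup>2"
  shows "\<exists>U :: nat \<Rightarrow> nat. mono U \<and> (\<forall>i\<in>{a..<b}. real (U i + 1) \<le> 3 * s / t) \<and>
    (\<forall>i j. a \<le> i \<longrightarrow> i \<le> j \<longrightarrow> U i = U j \<longrightarrow> real (j - i) * (\<Sum>l\<in>{i<..j}. w l) \<le> t\<^sup>2)"
proof -
  define N where "N = real (b - a)"
  have N: "N > 0" and s: "s > 0"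
    using ab ts by (auto simp: N_def)
  \<comment> \<open>The scaling makes lengths contribute \<open>s / t\<close> over the whole of
    \<open>{a..<b}\<close> and masses at most the same. Labels are thus at most
    \<open>2 * s / t\<close>, and counting from 0 adds one more, absorbed since
    \<open>s / t \<ge> 1\<close>.\<close>
  define u where "u i = s / (t * N) + N * w i / (s * t)" for i
  have u: "0 \<le> u i" for i
    using N s ts w by (auto simp: u_def)
  define V where "V i = (\<Sum>l\<in>{a..i}. u l)" for i
  have V0: "0 \<le> V i" for i
    unfolding V_def by (intro sum_nonneg u)
  have Vmono: "V i \<le> V j" if "i \<le> j" for i j
    unfolding V_def using that by (intro sum_mono2 u) auto
  define U where "U i = nat \<lfloor>V i\<rfloor>" for i
  have "mono U"
    unfolding U_def by (intro monoI nat_mono floor_mono Vmono)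
  moreover have "real (U i + 1) \<le> 3 * s / t" if "i \<in> {a..<b}" for i
  proof -
    have "V i \<le> (\<Sum>l\<in>{a..<b}. u l)"
      unfolding V_def using that by (intro sum_mono2 u) auto
    also have "\<dots> = s / t + N * (\<Sum>i\<in>{a..<b}. w i) / (s * t)"
      using N by (simp add: u_def sum.distrib N_def[symmetric] sum_distrib_left sum_divide_distrib)
    also have "\<dots> \<le> s / t + s\<^sup>2 / (s * t)"
      using mass s ts by (intro add_left_mono divide_right_mono) (auto simp: N_def)
    also have "s\<^sup>2 / (s * t) = s / t"
      using s by (simp add: power2_eq_square)
    finally have "V i \<le> 2 * s / t" by simp
    moreover have "real (U i) \<le> V i"
      unfolding U_def using V0[of i] by simp
    moreover have "1 \<le> s / t"
      using ts by simp
    ultimately show ?thesis by simp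
  qed
  moreover have "real (j - i) * (\<Sum>l\<in>{i<..j}. w l) \<le> t\<^sup>2" if ij: "a \<le> i" "i \<le> j" "U i = U j" for i j
  proof -
    \<comment> \<open>Equal integer parts force an increment below 1. As \<open>V i\<close> already
      includes \<open>u i\<close>, the increment counts exactly the half-open interval
      \<open>{i<..j}\<close>.\<close>
    have "\<lfloor>V i\<rfloor> = \<lfloor>V j\<rfloor>"
      using ij(3) V0[of i] V0[of j] by (simp add: U_def eq_nat_nat_iff)
    then have "V j - V i < 1"
      by linarith
    moreover have "V j = V i + (\<Sum>l\<in>{i<..j}. u l)"
    proof -
      have "{a..j} = {a..i} \<union> {i<..j}" "{a..i} \<inter> {i<..j} = {}" using ij by auto
      then show ?thesis
        unfolding V_def by (simp add: sum.union_disjoint)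
    qed
    ultimately have "(\<Sum>l\<in>{i<..j}. u l) < 1" by simp
    moreover have "(\<Sum>l\<in>{i<..j}. u l) = real (j - i) * s / (t * N) + N * (\<Sum>l\<in>{i<..j}. w l) / (s * t)"
      by (simp add: u_def sum.distrib sum_distrib_left sum_divide_distrib)
    moreover have "0 \<le> real (j - i) * s / (t * N)" "0 \<le> N * (\<Sum>l\<in>{i<..j}. w l) / (s * t)"
      using N s ts w by (auto intro!: mult_nonneg_nonneg divide_nonneg_nonneg sum_nonneg)
    ultimately have "real (j - i) * s / (t * N) \<le> 1" "N * (\<Sum>l\<in>{i<..j}. w l) / (s * t) \<le> 1"
      by linarith+
    then have "real (j - i) \<le> t * N / s" "(\<Sum>l\<in>{i<..j}. w l) \<le> s * t / N"
      using N s ts by (auto simp: field_simps)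
    \<comment> \<open>The bounds on length and mass are reciprocal in \<open>N\<close> and
      \<open>s\<close>, so only \<open>t\<close> survives in their product.\<close>
    then have "real (j - i) * (\<Sum>l\<in>{i<..j}. w l) \<le> (t * N / s) * (s * t / N)"
      using N s ts w by (intro mult_mono) (auto intro!: sum_nonneg)
    also have "\<dots> = t\<^sup>2"
      using N s by (simp add: power2_eq_square)
    finally show ?thesis .
  qed
  ultimately show ?thesis by blast
qed

section \<open>Sufficiency\<close>

text \<open>The numbering follows \<open>rsigma_seq\<close>: block 0 is \<open>{0}\<close>, and
  block \<open>k + 1\<close> is \<open>{2^k..<2^(k+1)}\<close>.\<close>

definition dyadic_block :: "nat \<Rightarrow> nat" where
  "dyadic_block i = (LEAST k. i < 2^k)"

text \<open>The left end \<open>2^k div 2\<close> is 0 for \<open>k = 0\<close>, so one formula also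
  covers the block \<open>{0}\<close>.\<close>

lemma dyadic_block_eq_iff: "dyadic_block i = k \<longleftrightarrow> i \<in> {2^k div 2..<2^k}"
proof
  assume k: "dyadic_block i = k"
  have "i < 2^k"
    using LeastI[of "\<lambda>k. i < 2^k" i] less_exp[of i] k by (simp add: dyadic_block_def)
  moreover have "2^k div 2 \<le> i"
  proof (cases k)
    case (Suc k')
    then have "\<not> i < 2^k'"
      using k not_less_Least[of k' "\<lambda>k. i < 2^k"] by (simp add: dyadic_block_def)
    with Suc show ?thesis by simp
  qed simp
  ultimately show "i \<in> {2^k div 2..<2^k}" by simp
next
  assume i: "i \<in> {2^k div 2..<2^k}"
  show "dyadic_block i = k"
    unfolding dyadic_block_def
  proof (rule Least_equality)
    fix y assume y: "i < 2^y"
    show "k \<le> y"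
    proof (rule ccontr)
      assume "\<not> k \<le> y"
      then obtain k' where k': "k = Suc k'" "y \<le> k'"
        by (cases k) auto
      then have "(2::nat)^y \<le> 2^k'"
        by (intro power_increasing) auto
      with i y k' show False by simp
    qed
  qed (use i in simp)
qed

lemma dyadic_block_between:
  assumes "i \<le> j" "j \<le> l" "dyadic_block i = dyadic_block l"
  shows "dyadic_block j = dyadic_block l"
proof -
  have "i \<in> {2^dyadic_block l div 2..<2^dyadic_block l}"
    using assms(3) by (simp only: dyadic_block_eq_iff)
  moreover have "l \<in> {2^dyadic_block l div 2..<2^dyadic_block l}"
    using dyadic_block_eq_iff by blast
  ultimately have "j \<in> {2^dyadic_block l div 2..<2^dyadic_block l}"
    using assms(1,2) by auto
  then show ?thesis
    using dyadic_block_eq_iff by blast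
qed

section \<open>Piecewise constant approximation of the Rhaly operator\<close>

lemma rsigma_seq_nonneg: "0 \<le> rsigma_seq \<alpha> k"
  by (simp add: rsigma_seq_def rsigma_nonneg)

lemma rsigma_seq_square:
  "(rsigma_seq \<alpha> k)\<^sup>2 = (\<Sum>i\<in>{2^k div 2..<2^k}. real (i+1) * (cmod (\<alpha> i))\<^sup>2)"
proof (cases k)
  case 0
  then show ?thesis by (simp add: rsigma_seq_def)
next
  case (Suc k')
  then show ?thesis
    using rsigma_square[of \<alpha> k'] by (simp add: rsigma_seq_def)
qed

text \<open>The length of a block is at most \<open>i + 1\<close> for each \<open>i\<close> in it.
  This is the mass hypothesis needed to cut the block by
  \<open>ex_balanced_labelling\<close>.\<close>

lemma dyadic_mass_le:
  "real (2^k - 2^k div 2) * (\<Sum>i\<in>{2^k div 2..<2^k}. (cmod (\<alpha> i))\<^sup>2) \<le> (rsigma_seq \<alpha> k)\<^sup>2"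
  unfolding rsigma_seq_square sum_distrib_left
proof (intro sum_mono mult_right_mono)
  fix i assume "i \<in> {2^k div 2..<(2::nat)^k}"
  then have "2^k - 2^k div 2 \<le> i + 1"
    by (cases k) auto
  then show "real (2^k - 2^k div 2) \<le> real (i + 1)"
    by (simp only: of_nat_le_iff)
qed auto

text \<open>The range is spanned by the restrictions of \<open>\<alpha>\<close> to the fibres of
  \<open>p\<close> on \<open>B\<close>, one vector for each value of \<open>p\<close>. Boundedness
  comes from the finiteness of \<open>B\<close>.\<close>

lemma finite_rank_le_partial_sums:
  fixes \<alpha> :: "nat \<Rightarrow> complex" and p :: "nat \<Rightarrow> nat"
  assumes B: "finite B" and n: "card (p ` B) \<le> n"
  shows "finite_rank_le n (\<lambda>f i. if i \<in> B then \<alpha> i * (\<Sum>j\<le>p i. f j) else 0)" (is "finite_rank_le n ?P")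
  unfolding finite_rank_le_def
proof (intro conjI ballI allI)
  show "?P f \<in> l2" for f
    by (rule finite_support_l2) (use B in \<open>auto intro: finite_subset\<close>)
  show "?P (\<lambda>k. f k + g k) = (\<lambda>k. ?P f k + ?P g k)" for f g
    by (auto simp: fun_eq_iff sum.distrib algebra_simps)
  show "?P (\<lambda>k. c * f k) = (\<lambda>k. c * ?P f k)" for f c
    by (auto simp: fun_eq_iff sum_distrib_left[symmetric])
  define C where "C = sqrt (\<Sum>i\<in>B. (cmod (\<alpha> i) * real (p i + 1))\<^sup>2)"
  have C2: "C\<^sup>2 = (\<Sum>i\<in>B. (cmod (\<alpha> i) * real (p i + 1))\<^sup>2)"
    unfolding C_def by (intro real_sqrt_pow2 sum_nonneg) auto
  have C0: "0 \<le> C"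
    unfolding C_def by (intro real_sqrt_ge_zero sum_nonneg) auto
  show "\<exists>C::real. \<forall>f\<in>l2. l2nrm (?P f) \<le> ennreal C * l2nrm f"
  proof (intro exI[of _ C] ballI)
    fix f assume f: "f \<in> l2"
    define N where "N = sqrt (\<Sum>n. (cmod (f n))\<^sup>2)"
    have N: "0 \<le> N" "l2nrm f = ennreal N"
      using f by (auto simp: N_def l2nrm_def l2_def suminf_nonneg)
    have "l2nrm (?P f) \<le> ennreal (C * N)"
    proof (rule l2nrm_le)
      fix M
      have "(\<Sum>i<M. (cmod (?P f i))\<^sup>2) \<le> (\<Sum>i\<in>{..<M} \<union> B. (cmod (?P f i))\<^sup>2)"
        using B by (intro sum_mono2) auto
      also have "\<dots> = (\<Sum>i\<in>B. (cmod (?P f i))\<^sup>2)"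
        using B by (intro sum.mono_neutral_right) auto
      also have "\<dots> \<le> (\<Sum>i\<in>B. (cmod (\<alpha> i) * real (p i + 1) * N)\<^sup>2)"
      proof (intro sum_mono power_mono)
        fix i assume i: "i \<in> B"
        have "cmod (\<Sum>j\<le>p i. f j) \<le> (\<Sum>j\<le>p i. N)"
          unfolding N_def by (intro sum_norm_le cmod_le_l2_norm f)
        then have "cmod (\<alpha> i) * cmod (\<Sum>j\<le>p i. f j) \<le> cmod (\<alpha> i) * (real (p i + 1) * N)"
          by (intro mult_left_mono) auto
        with i show "cmod (?P f i) \<le> cmod (\<alpha> i) * real (p i + 1) * N"
          by (simp add: norm_mult mult_ac)
      qed auto
      also have "\<dots> = (C * N)\<^sup>2"
        unfolding power_mult_distrib[of _ N] C2 by (simp add: sum_distrib_right)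
      finally show "(\<Sum>i<M. (cmod (?P f i))\<^sup>2) \<le> (C * N)\<^sup>2" .
    qed (use C0 N in auto)
    then show "l2nrm (?P f) \<le> ennreal C * l2nrm f"
      using C0 N by (simp add: ennreal_mult)
  qed
  obtain h where h: "bij_betw h {0..<card (p ` B)} (p ` B)"
    using B ex_bij_betw_nat_finite by blast
  show "\<exists>v. \<forall>f\<in>l2. \<exists>c. ?P f = (\<lambda>k. \<Sum>i<n. c i * v i k)"
  proof (intro exI ballI)
    fix f :: "nat \<Rightarrow> complex"
    let ?c = "\<lambda>i. \<Sum>j\<le>h i. f j"
    \<comment> \<open>The enumeration \<open>h\<close> is only controlled below the number of values
      of \<open>p\<close>; the surplus vectors up to \<open>n\<close> are set to 0.\<close>
    let ?v = "\<lambda>i k. if i < card (p ` B) \<and> k \<in> B \<and> p k = h i then \<alpha> k else 0"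
    show "?P f = (\<lambda>k. \<Sum>i<n. ?c i * ?v i k)"
    proof
      fix k
      show "?P f k = (\<Sum>i<n. ?c i * ?v i k)"
      proof (cases "k \<in> B")
        case True
        then obtain i0 where i0: "i0 < card (p ` B)" "h i0 = p k"
          using h by (force simp: bij_betw_def image_iff)
        have "?v i k = (if i = i0 then \<alpha> k else 0)" for i
          using h i0 True by (auto simp: bij_betw_def inj_on_def)
        then have "(\<Sum>i<n. ?c i * ?v i k) = (\<Sum>i<n. if i = i0 then ?c i0 * \<alpha> k else 0)"
          by (intro sum.cong) auto
        then show ?thesis
          using True i0 n by simp
      qed simp
    qed
  qed
qed

text \<open>The set \<open>F\<close> contains all positions of the array of
  \<open>3 * rsigma_seq \<alpha> k / (m+1)\<close> with entry at least \<open>t\<close>. Block and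
  label of an interval give such a position, so \<open>card F\<close> bounds the number of intervals
  and hence the rank.\<close>

lemma approx_num_rhaly_le:
  assumes t: "0 < t" and F: "finite F" "card F \<le> n"
    and cover: "\<And>k m. t \<le> 3 * rsigma_seq \<alpha> k / real (m+1) \<Longrightarrow> (k, m) \<in> F"
  shows "approx_num (rhaly \<alpha>) n \<le> ennreal (4 * t)"
proof -
  define s where "s = rsigma_seq \<alpha>"
  define w where "w i = (cmod (\<alpha> i))\<^sup>2" for i
  have w: "0 \<le> w i" for i
    by (simp add: w_def)
  have "\<exists>U :: nat \<Rightarrow> nat. t \<le> s k \<longrightarrow> mono U \<and> (\<forall>i\<in>{2^k div 2..<2^k}. real (U i + 1) \<le> 3 * s k / t) \<and>
    (\<forall>i j. 2^k div 2 \<le> i \<longrightarrow> i \<le> j \<longrightarrow> U i = U j \<longrightarrow> real (j - i) * (\<Sum>l\<in>{i<..j}. w l) \<le> t\<^sup>2)" for k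
  proof (cases "t \<le> s k")
    case True
    show ?thesis
      using ex_balanced_labelling[of w t "s k" "2^k div 2" "2^k", OF w t True]
        dyadic_mass_le[of k \<alpha>] by (auto simp: w_def s_def)
  qed simp
  then obtain U :: "nat \<Rightarrow> nat \<Rightarrow> nat" where
    U: "\<And>k. t \<le> s k \<Longrightarrow> mono (U k) \<and> (\<forall>i\<in>{2^k div 2..<2^k}. real (U k i + 1) \<le> 3 * s k / t) \<and>
      (\<forall>i j. 2^k div 2 \<le> i \<longrightarrow> i \<le> j \<longrightarrow> U k i = U k j \<longrightarrow> real (j - i) * (\<Sum>l\<in>{i<..j}. w l) \<le> t\<^sup>2)"
    by metis
  define B where "B = {i. t \<le> s (dyadic_block i)}"
  define start where "start k u = (LEAST j. dyadic_block j = k \<and> U k j = u)" for k u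
  \<comment> \<open>On large blocks \<open>p i\<close> is the first index with the same block and
    label. Elsewhere \<open>p i = i\<close>, so the sum over \<open>{p i<..i}\<close> is
    empty.\<close>
  define p where "p i = (if i \<in> B then start (dyadic_block i) (U (dyadic_block i) i) else i)" for i
  have p_le: "p i \<le> i" for i
    by (auto simp: p_def start_def intro!: Least_le)
  have p_label: "dyadic_block (p i) = dyadic_block i \<and> U (dyadic_block i) (p i) = U (dyadic_block i) i" for i
  proof (cases "i \<in> B")
    case True
    show ?thesis
      using LeastI[of "\<lambda>j. dyadic_block j = dyadic_block i \<and> U (dyadic_block i) j = U (dyadic_block i) i" i]
      by (simp add: p_def start_def True)
  qed (simp add: p_def)
  \<comment> \<open>Blocks are intervals and labels are monotone, so both are constant between
    \<open>p i\<close> and \<open>i\<close>.\<close>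
  have p_const: "p j = p i" if "p i < j" "j \<le> i" for i j
  proof -
    have iB: "i \<in> B"
      using that by (auto simp: p_def split: if_splits)
    have blk: "dyadic_block j = dyadic_block i"
      using dyadic_block_between[of "p i" j i] p_label[of i] that by auto
    have mono: "mono (U (dyadic_block i))"
      using U iB by (auto simp: B_def)
    have "U (dyadic_block i) (p i) \<le> U (dyadic_block i) j" "U (dyadic_block i) j \<le> U (dyadic_block i) i"
      using that monoD[OF mono, of "p i" j] monoD[OF mono, of j i] by auto
    then have "U (dyadic_block i) j = U (dyadic_block i) i"
      using p_label[of i] by simp
    then show ?thesis
      using iB blk by (simp add: p_def B_def)
  qed
  have p_mass: "real (i - p i) * (\<Sum>l\<in>{p i<..i}. w l) \<le> t\<^sup>2" for i
  proof (cases "i \<in> B")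
    case True
    have "2^dyadic_block i div 2 \<le> p i"
      using p_label[of i] dyadic_block_eq_iff[of "p i" "dyadic_block i"] by simp
    then show ?thesis
      using U[of "dyadic_block i"] True p_label[of i] p_le[of i] by (auto simp: B_def)
  qed (simp add: p_def)
  \<comment> \<open>A large block \<open>k\<close> already has the position \<open>(k, 0)\<close> in
    \<open>F\<close>, so there are finitely many large blocks.\<close>
  have "B \<subseteq> (\<Union>k\<in>fst ` F. {..<2^k})"
  proof
    fix i assume "i \<in> B"
    then have "t \<le> 3 * s (dyadic_block i) / real (0+1)"
      using t by (simp add: B_def)
    then have "(dyadic_block i, 0) \<in> F"
      unfolding s_def by (rule cover)
    moreover have "i < 2^dyadic_block i"
      using dyadic_block_eq_iff[of i "dyadic_block i"] by simp
    ultimately show "i \<in> (\<Union>k\<in>fst ` F. {..<2^k})"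
      by force
  qed
  then have finB: "finite B"
    by (rule finite_subset) (use F in auto)
  have "card (p ` B) \<le> card F"
  proof (rule card_inj_on_le[OF _ _ F(1)])
    let ?L = "\<lambda>r. (dyadic_block r, U (dyadic_block r) r)"
    have pstart: "r = start (dyadic_block r) (U (dyadic_block r) r)" if r: "r \<in> p ` B" for r
    proof -
      obtain i where i: "i \<in> B" "r = p i" using r by auto
      then have "r = start (dyadic_block i) (U (dyadic_block i) i)"
        by (simp add: p_def)
      with i show ?thesis
        using p_label[of i] by simp
    qed
    show "inj_on ?L (p ` B)"
      by (rule inj_onI) (metis pstart prod.inject)
    show "?L ` p ` B \<subseteq> F"
    proof (rule image_subsetI)
      fix r assume "r \<in> p ` B"
      then have big: "t \<le> s (dyadic_block r)"
        using p_label by (auto simp: B_def)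
      have "r \<in> {2^dyadic_block r div 2..<2^dyadic_block r}"
        using dyadic_block_eq_iff by blast
      then have "real (U (dyadic_block r) r + 1) \<le> 3 * s (dyadic_block r) / t"
        using U[OF big] by blast
      then have "t \<le> 3 * s (dyadic_block r) / real (U (dyadic_block r) r + 1)"
        using t by (simp add: field_simps)
      then show "?L r \<in> F"
        unfolding s_def by (rule cover)
    qed
  qed
  then have rank: "card (p ` B) \<le> n"
    using F(2) by simp
  let ?P = "\<lambda>f i. if i \<in> B then \<alpha> i * (\<Sum>j\<le>p i. f j) else 0"
  have "approx_num (rhaly \<alpha>) n \<le> opnorm (\<lambda>f i. rhaly \<alpha> f i - ?P f i)"
    unfolding approx_num_def using finite_rank_le_partial_sums[OF finB rank, of \<alpha>]
    by (intro INF_lower) simp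
  also have "\<dots> \<le> ennreal (4 * t)"
  proof (rule opnorm_le_triangular)
    fix f :: "nat \<Rightarrow> complex" and M
    define ws where "ws i = (if i \<in> B then 0 else w i)" for i
    define S where "S = (\<Sum>j<M. (cmod (f j))\<^sup>2)"
    \<comment> \<open>One of the two terms always vanishes: the first on large blocks, the second
      elsewhere. The square therefore splits without cross terms.\<close>
    have "(cmod (rhaly \<alpha> f i - ?P f i))\<^sup>2 =
        ws i * (cmod (\<Sum>j\<le>i. f j))\<^sup>2 + w i * (cmod (\<Sum>j\<in>{p i<..i}. f j))\<^sup>2" for i
    proof (cases "i \<in> B")
      case True
      have "{..i} = {..p i} \<union> {p i<..i}" "{..p i} \<inter> {p i<..i} = {}"
        using p_le[of i] by auto
      then have "(\<Sum>j\<le>i. f j) = (\<Sum>j\<le>p i. f j) + (\<Sum>j\<in>{p i<..i}. f j)"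
        by (simp add: sum.union_disjoint)
      then have "rhaly \<alpha> f i - ?P f i = \<alpha> i * (\<Sum>j\<in>{p i<..i}. f j)"
        using True by (simp add: rhaly_def algebra_simps)
      then show ?thesis
        using True by (simp add: ws_def w_def norm_mult power_mult_distrib)
    next
      case False
      then show ?thesis
        by (simp add: p_def ws_def w_def rhaly_def norm_mult power_mult_distrib)
    qed
    then have "(\<Sum>i<M. (cmod (rhaly \<alpha> f i - ?P f i))\<^sup>2) =
        (\<Sum>i<M. ws i * (cmod (\<Sum>j\<le>i. f j))\<^sup>2) + (\<Sum>i<M. w i * (cmod (\<Sum>j\<in>{p i<..i}. f j))\<^sup>2)"
      by (simp add: sum.distrib)
    moreover have "(\<Sum>i<M. ws i * (cmod (\<Sum>j\<le>i. f j))\<^sup>2) \<le> 12 * t\<^sup>2 * S"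
      unfolding S_def
    proof (rule dyadic_hardy_inequality)
      show "0 \<le> ws i" for i
        by (simp add: ws_def w)
      have small: "(\<Sum>i\<in>{2^k div 2..<2^k}. real (i+1) * ws i) \<le> t\<^sup>2" for k
      proof (cases "t \<le> s k")
        case True
        have "ws i = 0" if "i \<in> {2^k div 2..<2^k}" for i
          using True that dyadic_block_eq_iff[of i k] by (auto simp: ws_def B_def)
        then show ?thesis by simp
      next
        case False
        have "(\<Sum>i\<in>{2^k div 2..<2^k}. real (i+1) * ws i) \<le> (s k)\<^sup>2"
          unfolding s_def rsigma_seq_square
          by (intro sum_mono mult_left_mono) (auto simp: ws_def w_def)
        also have "\<dots> \<le> t\<^sup>2"
          using False by (intro power_mono) (auto simp: s_def rsigma_seq_nonneg)
        finally show ?thesis .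
      qed
      show "(\<Sum>i\<in>{2^k..<2^(k+1)}. real (i+1) * ws i) \<le> t\<^sup>2" for k
        using small[of "k+1"] by simp
      show "ws 0 \<le> t\<^sup>2"
        using small[of 0] by simp
    qed
    moreover have "(\<Sum>i<M. w i * (cmod (\<Sum>j\<in>{p i<..i}. f j))\<^sup>2) \<le> t\<^sup>2 * S"
      unfolding S_def by (rule piecewise_sum_inequality[OF w p_const p_mass])
    moreover have "0 \<le> t\<^sup>2 * S"
      unfolding S_def by (intro mult_nonneg_nonneg sum_nonneg) auto
    \<comment> \<open>The two parts give 12 + 1 = 13, which is below 16, the square of 4.\<close>
    ultimately show "(\<Sum>i<M. (cmod (rhaly \<alpha> f i - ?P f i))\<^sup>2) \<le> (4 * t)\<^sup>2 * (\<Sum>j<M. (cmod (f j))\<^sup>2)"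
      by (simp add: S_def power_mult_distrib)
  qed (use t in simp)
  finally show ?thesis .
qed

text \<open>Approximation numbers, divided by 8, are matched greedily with distinct entries of the
  array \<open>v\<close>. This replaces the decreasing rearrangement, and the array has a finite sum
  of \<open>q\<close>-th powers.\<close>

lemma schatten_if_summable_rsigma_seq:
  assumes sm: "summable (\<lambda>k. rsigma_seq \<alpha> k powr q)" and q: "1 < q"
  shows "schatten q (rhaly \<alpha>)"
proof -
  define s where "s = rsigma_seq \<alpha>"
  define S where "S = (\<Sum>k. s k powr q)"
  have s0: "0 \<le> s k" for k
    by (simp add: s_def rsigma_seq_nonneg)
  have sm: "summable (\<lambda>k. s k powr q)"
    using sm by (simp add: s_def)
  have S_ge: "(\<Sum>k\<in>X. s k powr q) \<le> S" if "finite X" for X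
    unfolding S_def using that by (intro sum_le_suminf sm) auto
  define T where "T = S powr (1/q)"
  have s_le: "s k \<le> T" for k
  proof -
    have "(s k powr q) powr (1/q) \<le> S powr (1/q)"
      using S_ge[of "{k}"] q by (intro powr_mono2) auto
    then show ?thesis
      using q s0[of k] by (simp add: T_def powr_powr)
  qed
  have fin: "approx_num (rhaly \<alpha>) n < \<infinity>" for n
  proof -
    \<comment> \<open>The threshold \<open>3 * T + 1\<close> exceeds every entry of the array, so
      the empty set covers and even rank 0 gives a finite error.\<close>
    have "approx_num (rhaly \<alpha>) n \<le> ennreal (4 * (3 * T + 1))"
    proof (rule approx_num_rhaly_le[where F = "{}"])
      show "0 < 3 * T + 1"
        using s_le[of 0] s0[of 0] by linarith
      fix k m
      have "3 * s k / real (m+1) \<le> 3 * s k / 1"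
        using s0 by (intro divide_left_mono) auto
      also have "\<dots> < 3 * T + 1"
        using s_le[of k] by simp
      finally show "3 * T + 1 \<le> 3 * rsigma_seq \<alpha> k / real (m+1) \<Longrightarrow> (k, m) \<in> {}"
        by (simp add: s_def)
    qed auto
    then show ?thesis
      by (rule le_less_trans) simp
  qed
  define a where "a n = enn2real (approx_num (rhaly \<alpha>) n)" for n
  define v where "v = (\<lambda>(k, m). 3 * s k / real (m+1))"
  have v0: "0 \<le> v x" for x
    by (cases x) (simp add: v_def s0)
  have greedy: "\<exists>F. finite F \<and> card F = M \<and> (\<Sum>n<M. (a n / 8) powr q) \<le> (\<Sum>x\<in>F. v x powr q)" for M
  proof (induction M)
    case 0
    show ?case by (intro exI[of _ "{}"]) simp
  next
    case (Suc M)
    then obtain F where F: "finite F" "card F = M" "(\<Sum>n<M. (a n / 8) powr q) \<le> (\<Sum>x\<in>F. v x powr q)"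
      by blast
    have "\<exists>x. x \<notin> F \<and> a M / 8 \<le> v x"
    proof (rule ccontr)
      \<comment> \<open>Otherwise \<open>F\<close> covers the threshold \<open>a M / 8\<close>, and
        the upper bound yields \<open>a M \<le> a M / 2\<close>. The factor 8 is taken as twice the
        constant 4 of that bound, and strict positivity of \<open>a M\<close> follows from an entry
        outside \<open>F\<close>.\<close>
      assume none: "\<nexists>x. x \<notin> F \<and> a M / 8 \<le> v x"
      obtain x where "x \<notin> F"
        using F(1) ex_new_if_finite[of F] by (auto simp: finite_prod)
      with none v0[of x] have pos: "0 < a M / 8"
        by fastforce
      have "approx_num (rhaly \<alpha>) M \<le> ennreal (4 * (a M / 8))"
      proof (rule approx_num_rhaly_le[OF pos F(1)])
        fix k m
        assume "a M / 8 \<le> 3 * rsigma_seq \<alpha> k / real (m+1)"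
        then have "a M / 8 \<le> v (k, m)"
          by (simp add: v_def s_def)
        with none show "(k, m) \<in> F" by blast
      qed (simp add: F)
      then have "a M \<le> enn2real (ennreal (4 * (a M / 8)))"
        unfolding a_def[of M] by (intro enn2real_mono) auto
      with pos show False by simp
    qed
    then obtain x where x: "x \<notin> F" "a M / 8 \<le> v x" by blast
    have "(a M / 8) powr q \<le> v x powr q"
      using x q by (intro powr_mono2) (auto simp: a_def)
    with F x show ?case
      by (intro exI[of _ "insert x F"]) auto
  qed
  define Z where "Z = (\<Sum>m. real (m+1) powr - q)"
  \<comment> \<open>The exponent condition \<open>q > 1\<close> enters here, through summation over
    the positions \<open>m\<close> within a block.\<close>
  have "summable (\<lambda>m. real m powr - q)"
    using summable_real_powr_iff[of "-q"] q by simp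
  then have smZ: "summable (\<lambda>m. real (m+1) powr - q)"
    using summable_iff_shift[of "\<lambda>m. real m powr - q" 1] by simp
  have v_sum: "(\<Sum>x\<in>F. v x powr q) \<le> 3 powr q * S * Z" if "finite F" for F
  proof -
    \<comment> \<open>Enlarging \<open>F\<close> to the product of its projections lets the double
      sum factor.\<close>
    have "(\<Sum>x\<in>F. v x powr q) \<le> (\<Sum>x\<in>fst ` F \<times> snd ` F. v x powr q)"
      using that by (intro sum_mono2) (auto simp: image_iff, force+)
    also have "\<dots> = (\<Sum>k\<in>fst ` F. \<Sum>m\<in>snd ` F. (3 powr q * s k powr q) * real (m+1) powr - q)"
      unfolding sum.cartesian_product
      by (intro sum.cong) (auto simp: v_def s0 powr_divide powr_mult powr_minus_divide)
    also have "\<dots> = 3 powr q * (\<Sum>k\<in>fst ` F. s k powr q) * (\<Sum>m\<in>snd ` F. real (m+1) powr - q)"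
      by (simp add: sum_product[symmetric] sum_distrib_left)
    also have "\<dots> \<le> 3 powr q * S * Z"
      unfolding Z_def using that S_ge[of "fst ` F"] S_ge[of "{}"]
      by (intro mult_mono sum_le_suminf smZ) (auto intro!: sum_nonneg)
    finally show ?thesis .
  qed
  have "summable (\<lambda>n. (a n / 8) powr q)"
  proof (rule summableI_nonneg_bounded)
    fix M
    show "(\<Sum>n<M. (a n / 8) powr q) \<le> 3 powr q * S * Z"
      using greedy[of M] v_sum by force
  qed simp
  then have "summable (\<lambda>n. 8 powr q * (a n / 8) powr q)"
    by (rule summable_mult)
  moreover have "8 powr q * (a n / 8) powr q = a n powr q" for n
    by (simp add: powr_mult[symmetric] a_def)
  ultimately have "summable (\<lambda>n. a n powr q)"
    by (simp only:)
  then show ?thesis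
    using fin unfolding schatten_def a_def by blast
qed

theorem theorem5p8:
  fixes \<alpha> :: "nat \<Rightarrow> complex" and q :: real
  assumes "\<alpha> \<in> l2" and "1 < q"
  shows "schatten q (rhaly \<alpha>) \<longleftrightarrow> summable (\<lambda>k. (rsigma_seq \<alpha> k) powr q)"
  using summable_rsigma_seq_if_schatten[of q \<alpha>] schatten_if_summable_rsigma_seq[of \<alpha> q] assms by auto

end
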